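(* A twisted right gyrogroup $(S,\circ)$ is a twisted gyrogroup if and only if $S$ is a twisted subgroup of the group $G_SS$ and $f(x,y)^{-1}=f(y,x)$ for all $x,y\in S$.
   Context: A right loop $(S,\circ)$ with identity $e$ is a set $S$ with a binary operation $\circ$ and a two-sided identity $e$ such that for all $a,b\in S$ the equation $x\circ a=b$ has a unique solution $x\in S$. The left inverse $x'$ of $x$ is the unique element with $x'\circ x=e$. For $y,z\in S$ the right inner mapping $f(y,z):S\to S$ is the bijection defined by $f(y,z)(x)\circ(y\circ z)=(x\circ y)\circ z$ for all $x\in S$; it fixes $e$. The inner mapping group $G_S$ is the subgroup of $Sym(S)$ generated by $\{f(y,z): y,z\in S\}$; products of maps are composed left to right: $(gf)(x)=f(g(x))$. A right loop $(S,\circ)$ is a twisted right gyrogroup if (i) $f(y',y)=I_S$ (the identity map) for all $y\in S$ (consequently $x'$ is the unique two-sided inverse of $x$ for every $x$), and (ii) every right inner mapping $f(y,z)$, $y,z\in S$, is a twisted automorphism, i.e. a bijection $h:S\to S$ with $h(x\circ y)=[h(x')]'\circ h(y)$ for all $x,y\in S$ with $y\neq e$. In that case $\eta:G_S\to G_S$, $\eta(h)(x)=(h(x'))'$ for $x\in S$, is an automorphism of $G_S$ with $\eta^2$ the identity, and $h(x\circ y)=\eta(h)(x)\circ h(y)$ for $h\in G_S$, $x,y\in S$, $y\neq e$. A twisted right gyrogroup $(S,\circ)$ is a twisted gyrogroup if $f(x,y)=f(x,x\circ y)$ for all $x,y\in S$ (right loop property). For a twisted right gyrogroup $(S,\circ)$,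 the group $G_SS$ is the set $G_S\times S$ with multiplication $(a,x)\cdot(b,y)=\bigl(a\,\eta(b)\,f(b(x),y),\ b(x)\circ y\bigr)$ if $x\neq e$ and $(a,e)\cdot(b,y)=(ab,y)$; its identity is $(I_S,e)$. $S$ is regarded as the subset $\{(I_S,x):x\in S\}$ of $G_SS$. A subset $T$ of a group $G$ is a twisted subgroup of $G$ if $1\in T$ and $xyx\in T$ for all $x,y\in T$. *)

theory Defs
  imports "HOL-Algebra.Bij" "HOL-Algebra.Generated_Groups"
begin

locale right_loop =
  fixes S (structure)
  assumes m_closed [intro, simp]: "\<lbrakk>x \<in> carrier S; y \<in> carrier S\<rbrakk> \<Longrightarrow> x \<otimes> y \<in> carrier S"
    and one_closed [intro, simp]: "\<one> \<in> carrier S"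
    and l_one [simp]: "x \<in> carrier S \<Longrightarrow> \<one> \<otimes> x = x"
    and r_one [simp]: "x \<in> carrier S \<Longrightarrow> x \<otimes> \<one> = x"
    and right_div: "\<lbrakk>a \<in> carrier S; b \<in> carrier S\<rbrakk> \<Longrightarrow> \<exists>!x. x \<in> carrier S \<and> x \<otimes> a = b"

definition left_inv :: "('a, 'b) monoid_scheme \<Rightarrow> 'a \<Rightarrow> 'a"
  where "left_inv S x = (THE x'. x' \<in> carrier S \<and> x' \<otimes>\<^bsub>S\<^esub> x = \<one>\<^bsub>S\<^esub>)"

definition inner_map :: "('a, 'b) monoid_scheme \<Rightarrow> 'a \<Rightarrow> 'a \<Rightarrow> 'a \<Rightarrow> 'a"
  where "inner_map S y z =
    (\<lambda>x\<in>carrier S. THE u. u \<in> carrier S \<and> u \<otimes>\<^bsub>S\<^esub> (y \<otimes>\<^bsub>S\<^esub> z) = (x \<otimes>\<^bsub>S\<^esub> y) \<otimes>\<^bsub>S\<^esub> z)"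

text \<open>Products of permutations are read from left to right, \<open>(g \<otimes> f) x = f (g x)\<close>. This is the
  opposite of the convention of \<^const>\<open>BijGroup\<close>; the carrier \<^const>\<open>Bij\<close> is the same.\<close>

definition Sym :: "'a set \<Rightarrow> ('a \<Rightarrow> 'a) monoid"
  where "Sym A = \<lparr>carrier = Bij A, mult = (\<lambda>g\<in>Bij A. \<lambda>f\<in>Bij A. compose A f g), one = (\<lambda>x\<in>A. x)\<rparr>"

definition inner_mapping_group :: "('a, 'b) monoid_scheme \<Rightarrow> ('a \<Rightarrow> 'a) set"
  where "inner_mapping_group S =
    generate (Sym (carrier S)) {inner_map S y z |y z. y \<in> carrier S \<and> z \<in> carrier S}"

definition twisted_automorphism :: "('a, 'b) monoid_scheme \<Rightarrow> ('a \<Rightarrow> 'a) \<Rightarrow> bool"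
  where "twisted_automorphism S h \<longleftrightarrow> h \<in> Bij (carrier S) \<and>
    (\<forall>x\<in>carrier S. \<forall>y\<in>carrier S. y \<noteq> \<one>\<^bsub>S\<^esub> \<longrightarrow>
      h (x \<otimes>\<^bsub>S\<^esub> y) = left_inv S (h (left_inv S x)) \<otimes>\<^bsub>S\<^esub> h y)"

locale twisted_right_gyrogroup = right_loop +
  assumes inner_map_left_inv:
      "y \<in> carrier S \<Longrightarrow> inner_map S (left_inv S y) y = (\<lambda>x\<in>carrier S. x)"
    and inner_map_twisted:
      "\<lbrakk>y \<in> carrier S; z \<in> carrier S\<rbrakk> \<Longrightarrow> twisted_automorphism S (inner_map S y z)"

locale twisted_gyrogroup = twisted_right_gyrogroup +
  assumes right_loop_property:
    "\<lbrakk>x \<in> carrier S; y \<in> carrier S\<rbrakk> \<Longrightarrow> inner_map S x y = inner_map S x (x \<otimes> y)"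

definition eta :: "('a, 'b) monoid_scheme \<Rightarrow> ('a \<Rightarrow> 'a) \<Rightarrow> 'a \<Rightarrow> 'a"
  where "eta S h = (\<lambda>x\<in>carrier S. left_inv S (h (left_inv S x)))"

definition GSS :: "('a, 'b) monoid_scheme \<Rightarrow> (('a \<Rightarrow> 'a) \<times> 'a) monoid"
  where "GSS S =
    \<lparr>carrier = inner_mapping_group S \<times> carrier S,
     mult = (\<lambda>(a, x) (b, y).
       if x = \<one>\<^bsub>S\<^esub> then (a \<otimes>\<^bsub>Sym (carrier S)\<^esub> b, y)
       else (a \<otimes>\<^bsub>Sym (carrier S)\<^esub> eta S b \<otimes>\<^bsub>Sym (carrier S)\<^esub> inner_map S (b x) y,
             b x \<otimes>\<^bsub>S\<^esub> y)),
     one = (\<one>\<^bsub>Sym (carrier S)\<^esub>, \<one>\<^bsub>S\<^esub>)\<rparr>"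

definition GSS_embed :: "('a, 'b) monoid_scheme \<Rightarrow> (('a \<Rightarrow> 'a) \<times> 'a) set"
  where "GSS_embed S = {(\<lambda>u\<in>carrier S. u, x) |x. x \<in> carrier S}"

locale twisted_subgroup = group +
  fixes T
  assumes subset: "T \<subseteq> carrier G"
    and one_mem: "\<one> \<in> T"
    and twisted_closed: "\<lbrakk>x \<in> T; y \<in> T\<rbrakk> \<Longrightarrow> x \<otimes> y \<otimes> x \<in> T"

lemma Sym_simps [simp]: "carrier (Sym A) = Bij A" "\<one>\<^bsub>Sym A\<^esub> = (\<lambda>x\<in>A. x)"
  by (auto simp: Sym_def)

lemma Sym_mult: "\<lbrakk>g \<in> Bij A; f \<in> Bij A\<rbrakk> \<Longrightarrow> g \<otimes>\<^bsub>Sym A\<^esub> f = (\<lambda>x\<in>A. f (g x))"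
  by (auto simp: Sym_def compose_def)

lemma Bij_mem: "\<lbrakk>f \<in> Bij A; x \<in> A\<rbrakk> \<Longrightarrow> f x \<in> A"
  using funcset_mem[OF Bij_imp_funcset] .

lemma Bij_eqI: "\<lbrakk>f \<in> Bij A; g \<in> Bij A; \<And>x. x \<in> A \<Longrightarrow> f x = g x\<rbrakk> \<Longrightarrow> f = g"
  by (rule extensionalityI[of _ A]) (simp_all add: Bij_imp_extensional)

lemma BijI:
  assumes "f \<in> extensional A" "\<And>b. b \<in> A \<Longrightarrow> \<exists>!a. a \<in> A \<and> f a = b" "\<And>a. a \<in> A \<Longrightarrow> f a \<in> A"
  shows "f \<in> Bij A"
proof -
  have "inj_on f A"
    using assms(2,3) by (intro inj_onI) metis
  moreover have "f ` A = A"
    using assms(3) ex1_implies_ex[OF assms(2)] by (auto simp: image_iff)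
  ultimately show ?thesis
    using assms(1) by (simp add: Bij_def bij_betw_def)
qed

lemma group_Sym: "group (Sym A)"
proof (rule groupI)
  fix f assume f: "f \<in> carrier (Sym A)"
  then show "\<exists>g\<in>carrier (Sym A). g \<otimes>\<^bsub>Sym A\<^esub> f = \<one>\<^bsub>Sym A\<^esub>"
    using f restrict_inv_into_Bij[of f A]
    by (intro bexI[of _ "\<lambda>x\<in>A. inv_into A f x"])
       (auto simp: Sym_mult Bij_def bij_betw_def f_inv_into_f intro!: restrict_ext)
next
  fix f assume "f \<in> carrier (Sym A)"
  then show "\<one>\<^bsub>Sym A\<^esub> \<otimes>\<^bsub>Sym A\<^esub> f = f"
    by (intro Bij_eqI[of _ A]) (simp_all add: Sym_def compose_Bij id_Bij, simp add: compose_def)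
qed (auto simp: Sym_def compose_Bij id_Bij Bij_imp_funcset compose_assoc)

context right_loop
begin

lemma right_cancel: "\<lbrakk>x \<in> carrier S; y \<in> carrier S; a \<in> carrier S; x \<otimes> a = y \<otimes> a\<rbrakk> \<Longrightarrow> x = y"
  using right_div[of a "y \<otimes> a"] by auto

lemma left_inv: 
  assumes "x \<in> carrier S" shows "left_inv S x \<in> carrier S" "left_inv S x \<otimes> x = \<one>"
  using theI'[OF right_div[OF assms one_closed]] by (auto simp: left_inv_def)

lemma inner_map:
  assumes "x \<in> carrier S" "y \<in> carrier S" "z \<in> carrier S"
  shows "inner_map S y z x \<in> carrier S" "inner_map S y z x \<otimes> (y \<otimes> z) = x \<otimes> y \<otimes> z"
  using theI'[OF right_div[of "y \<otimes> z" "x \<otimes> y \<otimes> z"]] assms by (auto simp: inner_map_def)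

definition rtrans :: "'a \<Rightarrow> 'a \<Rightarrow> 'a" where "rtrans y = (\<lambda>x\<in>carrier S. x \<otimes> y)"

lemma rtrans_Bij: "y \<in> carrier S \<Longrightarrow> rtrans y \<in> Bij (carrier S)"
  using right_div by (intro BijI) (simp_all add: rtrans_def cong: conj_cong)

lemma inner_map_Bij:
  assumes y: "y \<in> carrier S" and z: "z \<in> carrier S"
  shows "inner_map S y z \<in> Bij (carrier S)"
proof (rule BijI)
  fix b assume b: "b \<in> carrier S"
  obtain w where w: "w \<in> carrier S" "w \<otimes> z = b \<otimes> (y \<otimes> z)"
    using ex1_implies_ex[OF right_div[OF z, of "b \<otimes> (y \<otimes> z)"]] b y z by auto
  obtain a where a: "a \<in> carrier S" "a \<otimes> y = w"
    using ex1_implies_ex[OF right_div[OF y w(1)]] by auto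
  show "\<exists>!a. a \<in> carrier S \<and> inner_map S y z a = b"
  proof (rule ex1I[of _ a])
    show "a \<in> carrier S \<and> inner_map S y z a = b"
      using a w b y z inner_map[of a y z]
      by (intro conjI right_cancel[of "inner_map S y z a" b "y \<otimes> z"]) simp_all
  next
    fix c assume "c \<in> carrier S \<and> inner_map S y z c = b"
    then have c: "c \<in> carrier S" "inner_map S y z c = b" by auto
    then have "c \<otimes> y \<otimes> z = w \<otimes> z" using w y z inner_map(2)[of c y z] by simp
    then have "c \<otimes> y = a \<otimes> y" using right_cancel[of "c \<otimes> y" w z] a w y z c by simp
    then show "c = a" using right_cancel[of c a y] a y c by simp
  qed
next
  show "inner_map S y z \<in> extensional (carrier S)" by (simp add: inner_map_def)
next
  fix a assume "a \<in> carrier S"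
  then show "inner_map S y z a \<in> carrier S" using inner_map(1)[OF _ y z] by simp
qed

lemma inner_map_one: "\<lbrakk>y \<in> carrier S; z \<in> carrier S\<rbrakk> \<Longrightarrow> inner_map S y z \<one> = \<one>"
  by (rule right_cancel[of _ _ "y \<otimes> z"]) (simp_all add: inner_map)

lemma rtrans_mult:
  assumes "y \<in> carrier S" "z \<in> carrier S"
  shows "rtrans y \<otimes>\<^bsub>Sym (carrier S)\<^esub> rtrans z
    = inner_map S y z \<otimes>\<^bsub>Sym (carrier S)\<^esub> rtrans (y \<otimes> z)"
  using assms inner_map(1)[OF _ assms] inner_map(2)[OF _ assms]
  by (simp add: Sym_mult rtrans_Bij inner_map_Bij) (simp add: rtrans_def cong: restrict_cong)

lemma inner_mapping_group_subgroup: "subgroup (inner_mapping_group S) (Sym (carrier S))"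
  unfolding inner_mapping_group_def
proof (rule group.generate_is_subgroup[OF group_Sym])
  show "{inner_map S y z |y z. y \<in> carrier S \<and> z \<in> carrier S} \<subseteq> carrier (Sym (carrier S))"
    by (safe, simp only: Sym_simps inner_map_Bij)
qed

lemma inner_mapping_group_induct:
  assumes "subgroup K (Sym (carrier S))"
    and "\<And>y z. \<lbrakk>y \<in> carrier S; z \<in> carrier S\<rbrakk> \<Longrightarrow> inner_map S y z \<in> K"
    and "h \<in> inner_mapping_group S"
  shows "h \<in> K"
proof -
  have "{inner_map S y z |y z. y \<in> carrier S \<and> z \<in> carrier S} \<subseteq> K"
    by (safe, rule assms(2))
  from group.generate_subgroup_incl[OF group_Sym this assms(1)] show ?thesis
    using assms(3) unfolding inner_mapping_group_def by (rule subsetD)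
qed

end

context twisted_right_gyrogroup
begin

lemma left_inv_left_inv:
  assumes x: "x \<in> carrier S" shows "left_inv S (left_inv S x) = x"
proof -
  let ?x' = "left_inv S x"
  have x': "?x' \<in> carrier S" "?x' \<otimes> x = \<one>" using left_inv[OF x] by simp_all
  have eq: "x \<otimes> ?x' \<otimes> x = \<one> \<otimes> x"
  proof -
    have "x \<otimes> ?x' \<otimes> x = inner_map S ?x' x x \<otimes> (?x' \<otimes> x)"
      by (rule inner_map(2)[symmetric]) (use x x' in simp_all)
    also have "inner_map S ?x' x x = x" using inner_map_left_inv[of x] x by simp
    finally show ?thesis using x x' by simp
  qed
  have xx': "x \<otimes> ?x' = \<one>"
    by (rule right_cancel[OF m_closed[OF x x'(1)] one_closed x eq])
  show ?thesis
    by (rule right_cancel[OF left_inv(1)[OF x'(1)] x x'(1)]) (simp only: left_inv(2)[OF x'(1)] xx')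
qed

lemma right_inv: "x \<in> carrier S \<Longrightarrow> x \<otimes> left_inv S x = \<one>"
  by (metis left_inv left_inv_left_inv)

lemma left_inv_one: "left_inv S \<one> = \<one>"
  using left_inv[of \<one>] by simp

abbreviation (input) M where "M \<equiv> Sym (carrier S)"
definition J where "J = (\<lambda>x\<in>carrier S. left_inv S x)"

lemma J_Bij: "J \<in> Bij (carrier S)"
proof (rule BijI)
  fix b assume "b \<in> carrier S"
  then show "\<exists>!a. a \<in> carrier S \<and> J a = b"
    by (intro ex1I[of _ "left_inv S b"]) (auto simp: J_def left_inv left_inv_left_inv)
qed (auto simp: J_def left_inv)

lemma J_J: "J \<otimes>\<^bsub>M\<^esub> J = \<one>\<^bsub>M\<^esub>"
  by (simp add: Sym_mult J_Bij) (simp add: J_def left_inv left_inv_left_inv cong: restrict_cong)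

lemma eta_conj:
  assumes "h \<in> Bij (carrier S)" shows "eta S h = J \<otimes>\<^bsub>M\<^esub> h \<otimes>\<^bsub>M\<^esub> J"
proof -
  interpret M: group M by (rule group_Sym)
  have "J \<otimes>\<^bsub>M\<^esub> h \<in> Bij (carrier S)" using M.m_closed[of J h] J_Bij assms by auto
  then show ?thesis
    using assms left_inv Bij_mem[OF assms]
    by (auto simp: Sym_mult J_Bij eta_def) (auto simp: J_def intro!: restrict_ext)
qed

lemma eta_Bij: "h \<in> Bij (carrier S) \<Longrightarrow> eta S h \<in> Bij (carrier S)"
  using monoid.m_closed[OF group.is_monoid[OF group_Sym[of "carrier S"]]] J_Bij
  by (simp add: eta_conj)

lemma eta_mult:
  assumes "g \<in> Bij (carrier S)" "h \<in> Bij (carrier S)"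
  shows "eta S (g \<otimes>\<^bsub>M\<^esub> h) = eta S g \<otimes>\<^bsub>M\<^esub> eta S h"
proof -
  interpret M: group M by (rule group_Sym)
  note [simp] = assms J_Bij M.m_closed[simplified] M.m_assoc[simplified]
  have "J \<otimes>\<^bsub>M\<^esub> (J \<otimes>\<^bsub>M\<^esub> (h \<otimes>\<^bsub>M\<^esub> J)) = h \<otimes>\<^bsub>M\<^esub> J"
    using M.m_assoc[of J J "h \<otimes>\<^bsub>M\<^esub> J"] J_J M.l_one[of "h \<otimes>\<^bsub>M\<^esub> J"] by simp
  then show ?thesis by (simp add: eta_conj)
qed

lemma eta_one: "eta S \<one>\<^bsub>M\<^esub> = \<one>\<^bsub>M\<^esub>"
  by (simp add: eta_def left_inv left_inv_left_inv cong: restrict_cong)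

lemma eta_eta: "h \<in> Bij (carrier S) \<Longrightarrow> eta S (eta S h) = h"
  by (rule Bij_eqI[of _ "carrier S"])
     (auto simp: eta_Bij, auto simp: eta_def left_inv left_inv_left_inv Bij_mem)

lemma eta_inv:
  assumes h: "h \<in> Bij (carrier S)" shows "eta S (inv\<^bsub>M\<^esub> h) = inv\<^bsub>M\<^esub> (eta S h)"
proof -
  interpret M: group M by (rule group_Sym)
  have "inv\<^bsub>M\<^esub> h \<in> Bij (carrier S)" using M.inv_closed[of h] h by simp
  moreover from this have "eta S (inv\<^bsub>M\<^esub> h) \<otimes>\<^bsub>M\<^esub> eta S h = \<one>\<^bsub>M\<^esub>"
    using eta_mult[of "inv\<^bsub>M\<^esub> h" h] h M.l_inv[of h] eta_one by simp
  ultimately show ?thesis using M.inv_equality[of "eta S (inv\<^bsub>M\<^esub> h)" "eta S h"] eta_Bij h by simp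
qed

text \<open>The equation below is \<open>h (x \<otimes> y) = eta S h x \<otimes> h y\<close> for all \<open>x\<close>.\<close>

definition twisted_maps where
  "twisted_maps = {h \<in> Bij (carrier S). h \<one> = \<one> \<and>
     (\<forall>y\<in>carrier S - {\<one>}. rtrans y \<otimes>\<^bsub>M\<^esub> h = eta S h \<otimes>\<^bsub>M\<^esub> rtrans (h y))}"

lemma twisted_maps_nontriv:
  assumes "h \<in> Bij (carrier S)" "h \<one> = \<one>" "y \<in> carrier S - {\<one>}"
  shows "h y \<in> carrier S - {\<one>}"
proof -
  have "inj_on h (carrier S)" using assms(1) by (auto simp: Bij_def bij_betw_def)
  then show ?thesis using assms Bij_mem[OF assms(1)] by (auto dest: inj_onD[of h _ y \<one>])
qed

lemma twisted_maps_subgroup: "subgroup twisted_maps M"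
proof -
  interpret M: group M by (rule group_Sym)
  note [simp] = J_Bij eta_Bij rtrans_Bij
  show ?thesis
  proof (rule M.subgroupI)
    show "twisted_maps \<subseteq> carrier M" by (auto simp: twisted_maps_def)
    have "rtrans y \<otimes>\<^bsub>M\<^esub> \<one>\<^bsub>M\<^esub> = eta S \<one>\<^bsub>M\<^esub> \<otimes>\<^bsub>M\<^esub> rtrans y" if "y \<in> carrier S" for y
      unfolding eta_one using that M.l_one[of "rtrans y"] M.r_one[of "rtrans y"]
      by (simp del: Sym_simps(2))
    then have "\<one>\<^bsub>M\<^esub> \<in> twisted_maps"
      by (auto simp: twisted_maps_def id_Bij)
    then show "twisted_maps \<noteq> {}" by blast
  next
    fix g h assume g: "g \<in> twisted_maps" and h: "h \<in> twisted_maps"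
    have B [simp]: "g \<in> Bij (carrier S)" "h \<in> Bij (carrier S)" "g \<one> = \<one>" "h \<one> = \<one>"
      using g h by (auto simp: twisted_maps_def)
    show "g \<otimes>\<^bsub>M\<^esub> h \<in> twisted_maps"
      unfolding twisted_maps_def
    proof (intro CollectI conjI ballI)
      show "g \<otimes>\<^bsub>M\<^esub> h \<in> Bij (carrier S)" using M.m_closed[of g h] by simp
      show "(g \<otimes>\<^bsub>M\<^esub> h) \<one> = \<one>" by (simp add: Sym_mult)
      fix y assume y: "y \<in> carrier S - {\<one>}"
      have gy: "g y \<in> carrier S - {\<one>}" using twisted_maps_nontriv[OF _ _ y] by simp
      have hy: "h (g y) \<in> carrier S - {\<one>}" using twisted_maps_nontriv[OF _ _ gy] by simp
      have "rtrans y \<otimes>\<^bsub>M\<^esub> (g \<otimes>\<^bsub>M\<^esub> h) = rtrans y \<otimes>\<^bsub>M\<^esub> g \<otimes>\<^bsub>M\<^esub> h"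
        using y by (simp add: M.m_assoc)
      also have "\<dots> = eta S g \<otimes>\<^bsub>M\<^esub> rtrans (g y) \<otimes>\<^bsub>M\<^esub> h"
        using g y by (auto simp: twisted_maps_def)
      also have "\<dots> = eta S g \<otimes>\<^bsub>M\<^esub> (rtrans (g y) \<otimes>\<^bsub>M\<^esub> h)"
        using gy by (simp add: M.m_assoc)
      also have "\<dots> = eta S g \<otimes>\<^bsub>M\<^esub> (eta S h \<otimes>\<^bsub>M\<^esub> rtrans (h (g y)))"
        using h gy by (auto simp: twisted_maps_def)
      also have "\<dots> = eta S (g \<otimes>\<^bsub>M\<^esub> h) \<otimes>\<^bsub>M\<^esub> rtrans ((g \<otimes>\<^bsub>M\<^esub> h) y)"
      proof -
        have "(g \<otimes>\<^bsub>M\<^esub> h) y = h (g y)" using y by (simp add: Sym_mult)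
        then show ?thesis using hy by (simp add: M.m_assoc eta_mult)
      qed
      finally show "rtrans y \<otimes>\<^bsub>M\<^esub> (g \<otimes>\<^bsub>M\<^esub> h)
        = eta S (g \<otimes>\<^bsub>M\<^esub> h) \<otimes>\<^bsub>M\<^esub> rtrans ((g \<otimes>\<^bsub>M\<^esub> h) y)" .
    qed
  next
    fix h assume h: "h \<in> twisted_maps"
    have B [simp]: "h \<in> Bij (carrier S)" "h \<one> = \<one>"
      using h by (auto simp: twisted_maps_def)
    let ?k = "inv\<^bsub>M\<^esub> h"
    have k [simp]: "?k \<in> Bij (carrier S)" using M.inv_closed[of h] by simp
    have kh: "?k (h x) = x" "h (?k x) = x" if "x \<in> carrier S" for x
      using fun_cong[OF M.r_inv[of h], of x] fun_cong[OF M.l_inv[of h], of x] that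
      by (auto simp: Sym_mult)
    show "?k \<in> twisted_maps"
      unfolding twisted_maps_def
    proof (intro CollectI conjI ballI)
      show "?k \<one> = \<one>" using kh(1)[of \<one>] by simp
      fix y assume y: "y \<in> carrier S - {\<one>}"
      have ky: "?k y \<in> carrier S - {\<one>}"
        using twisted_maps_nontriv[OF _ _ y, of ?k] kh(1)[of \<one>] by simp
      have "rtrans (?k y) \<otimes>\<^bsub>M\<^esub> h = eta S h \<otimes>\<^bsub>M\<^esub> rtrans y"
        using h ky kh(2)[of y] y by (auto simp: twisted_maps_def)
      then have "eta S ?k \<otimes>\<^bsub>M\<^esub> (rtrans (?k y) \<otimes>\<^bsub>M\<^esub> h) \<otimes>\<^bsub>M\<^esub> ?k
          = eta S ?k \<otimes>\<^bsub>M\<^esub> (eta S h \<otimes>\<^bsub>M\<^esub> rtrans y) \<otimes>\<^bsub>M\<^esub> ?k"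
        by simp
      moreover have "eta S ?k \<otimes>\<^bsub>M\<^esub> (rtrans (?k y) \<otimes>\<^bsub>M\<^esub> h) \<otimes>\<^bsub>M\<^esub> ?k
          = eta S ?k \<otimes>\<^bsub>M\<^esub> rtrans (?k y)"
        using ky M.r_inv[of h] M.r_one[of "rtrans (?k y)"] 
          M.m_closed[of "rtrans (?k y)" h] by (simp add: M.m_assoc del: Sym_simps(2))
      moreover have "eta S ?k \<otimes>\<^bsub>M\<^esub> (eta S h \<otimes>\<^bsub>M\<^esub> rtrans y) \<otimes>\<^bsub>M\<^esub> ?k
          = rtrans y \<otimes>\<^bsub>M\<^esub> ?k"
        using y M.inv_solve_left'[of "eta S h" ] M.m_closed[of "eta S h" "rtrans y"]
          M.m_assoc[of "inv\<^bsub>M\<^esub> (eta S h)" "eta S h" "rtrans y"]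
          M.inv_closed[of "eta S h"] M.l_inv[of "eta S h"] M.l_one[of "rtrans y"]
        by (simp add: eta_inv del: Sym_simps(2))
      ultimately show "rtrans y \<otimes>\<^bsub>M\<^esub> ?k = eta S ?k \<otimes>\<^bsub>M\<^esub> rtrans (?k y)" by simp
    qed (rule k)
  qed
qed

lemma inner_map_twisted_maps:
  assumes "y \<in> carrier S" "z \<in> carrier S"
  shows "inner_map S y z \<in> twisted_maps"
  unfolding twisted_maps_def
proof (intro CollectI conjI ballI)
  fix w assume w: "w \<in> carrier S - {\<one>}"
  note B = inner_map_Bij[OF assms]
  have "inner_map S y z w \<in> carrier S" using w assms inner_map by auto
  then show "rtrans w \<otimes>\<^bsub>M\<^esub> inner_map S y z
      = eta S (inner_map S y z) \<otimes>\<^bsub>M\<^esub> rtrans (inner_map S y z w)"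
    using inner_map_twisted[OF assms] w Bij_mem[OF eta_Bij[OF B]]
    by (simp add: Sym_mult rtrans_Bij B eta_Bij)
       (auto simp: rtrans_def eta_def twisted_automorphism_def intro!: restrict_ext)
qed (use assms inner_map_Bij inner_map_one in auto)

lemma inner_mapping_group_twisted: "h \<in> inner_mapping_group S \<Longrightarrow> h \<in> twisted_maps"
  using inner_mapping_group_induct[OF twisted_maps_subgroup inner_map_twisted_maps] .

lemma eta_inner_map:
  assumes y: "y \<in> carrier S" and z: "z \<in> carrier S"
  shows "eta S (inner_map S y z) \<in> inner_mapping_group S"
proof (cases "carrier S = {\<one>}")
  case True
  have "eta S (inner_map S y z) = \<one>\<^bsub>M\<^esub>"
    using True left_inv_one inner_map_one[OF y z] by (auto simp: eta_def)
  then show ?thesis using subgroup.one_closed[OF inner_mapping_group_subgroup] by simp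
next
  case False
  then obtain x where x: "x \<in> carrier S - {\<one>}" using one_closed by blast
  interpret M: group M by (rule group_Sym)
  interpret G: subgroup "inner_mapping_group S" M by (rule inner_mapping_group_subgroup)
  let ?f = "inner_map S y z"
  have f: "?f \<in> Bij (carrier S)" using inner_map_Bij y z by auto
  have fx: "?f x \<in> carrier S" using x inner_map y z by auto
  have inc: "inner_map S a b \<in> inner_mapping_group S" if "a \<in> carrier S" "b \<in> carrier S" for a b
    using that unfolding inner_mapping_group_def by (blast intro: generate.incl)
  note [simp] = f fx y z rtrans_Bij inner_map_Bij eta_Bij inner_map(2)
  have x' [simp]: "x \<in> carrier S" using x by simp
  let ?w = "x \<otimes> y \<otimes> z"
  have mc [simp]: "a \<otimes>\<^bsub>M\<^esub> b \<in> Bij (carrier S)" if "a \<in> Bij (carrier S)" "b \<in> Bij (carrier S)" for a b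
    using M.m_closed that by simp
  have "rtrans x \<otimes>\<^bsub>M\<^esub> ?f \<otimes>\<^bsub>M\<^esub> rtrans (y \<otimes> z) = rtrans x \<otimes>\<^bsub>M\<^esub> rtrans y \<otimes>\<^bsub>M\<^esub> rtrans z"
    using rtrans_mult[OF y z] by (simp add: M.m_assoc)
  also have "\<dots> = inner_map S x y \<otimes>\<^bsub>M\<^esub> inner_map S (x \<otimes> y) z \<otimes>\<^bsub>M\<^esub> rtrans ?w"
    using rtrans_mult[of x y] rtrans_mult[of "x \<otimes> y" z] by (simp add: M.m_assoc)
  finally have 1: "rtrans x \<otimes>\<^bsub>M\<^esub> ?f \<otimes>\<^bsub>M\<^esub> rtrans (y \<otimes> z)
    = inner_map S x y \<otimes>\<^bsub>M\<^esub> inner_map S (x \<otimes> y) z \<otimes>\<^bsub>M\<^esub> rtrans ?w" .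
  have "rtrans x \<otimes>\<^bsub>M\<^esub> ?f = eta S ?f \<otimes>\<^bsub>M\<^esub> rtrans (?f x)"
    using inner_map_twisted_maps[OF y z] x by (simp add: twisted_maps_def)
  then have "rtrans x \<otimes>\<^bsub>M\<^esub> ?f \<otimes>\<^bsub>M\<^esub> rtrans (y \<otimes> z)
    = eta S ?f \<otimes>\<^bsub>M\<^esub> inner_map S (?f x) (y \<otimes> z) \<otimes>\<^bsub>M\<^esub> rtrans ?w"
    using rtrans_mult[of "?f x" "y \<otimes> z"] by (simp add: M.m_assoc)
  with 1 have "eta S ?f \<otimes>\<^bsub>M\<^esub> inner_map S (?f x) (y \<otimes> z)
      = inner_map S x y \<otimes>\<^bsub>M\<^esub> inner_map S (x \<otimes> y) z"
    using M.right_cancel by simp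
  then have "eta S ?f = inner_map S x y \<otimes>\<^bsub>M\<^esub> inner_map S (x \<otimes> y) z
      \<otimes>\<^bsub>M\<^esub> inv\<^bsub>M\<^esub> (inner_map S (?f x) (y \<otimes> z))"
    using M.inv_solve_right[of "eta S ?f"
        "inner_map S x y \<otimes>\<^bsub>M\<^esub> inner_map S (x \<otimes> y) z" "inner_map S (?f x) (y \<otimes> z)"] by simp
  then show ?thesis using inc by (auto intro!: G.m_closed G.m_inv_closed)
qed

lemma eta_closed:
  assumes "h \<in> inner_mapping_group S" shows "eta S h \<in> inner_mapping_group S"
proof -
  interpret M: group M by (rule group_Sym)
  interpret G: subgroup "inner_mapping_group S" M by (rule inner_mapping_group_subgroup)
  have B: "h \<in> inner_mapping_group S \<Longrightarrow> h \<in> Bij (carrier S)" for h using G.subset by auto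
  let ?K = "{h \<in> inner_mapping_group S. eta S h \<in> inner_mapping_group S}"
  have "subgroup ?K M"
  proof (rule M.subgroupI)
    show "?K \<noteq> {}" using G.one_closed eta_one by auto
  qed (auto simp: B eta_inv eta_mult)
  moreover have "inner_map S y z \<in> ?K" if "y \<in> carrier S" "z \<in> carrier S" for y z
    using that eta_inner_map unfolding inner_mapping_group_def by (blast intro: generate.incl)
  ultimately show ?thesis using inner_mapping_group_induct[of ?K h] assms by blast
qed

text \<open>Sending \<open>(a, x)\<close> to \<open>a\<close> followed by right translation by \<open>x\<close> embeds \<^term>\<open>GSS S\<close> into
  the symmetric group; in particular the multiplication is associative.\<close>

definition to_perm where "to_perm = (\<lambda>(a, x). a \<otimes>\<^bsub>M\<^esub> rtrans x)"

theorem group_GSS: "group (GSS S)"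
proof -
  interpret M: group M by (rule group_Sym)
  interpret G: subgroup "inner_mapping_group S" M by (rule inner_mapping_group_subgroup)
  have B [simp]: "h \<in> inner_mapping_group S \<Longrightarrow> h \<in> Bij (carrier S)" for h using G.subset by auto
  have inc: "inner_map S a b \<in> inner_mapping_group S" if "a \<in> carrier S" "b \<in> carrier S" for a b
    using that unfolding inner_mapping_group_def by (blast intro: generate.incl)
  have c: "carrier (GSS S) = inner_mapping_group S \<times> carrier S" by (simp add: GSS_def)
  have o: "\<one>\<^bsub>GSS S\<^esub> = (\<one>\<^bsub>M\<^esub>, \<one>)" by (simp add: GSS_def)
  have fix1: "h \<one> = \<one>" if "h \<in> inner_mapping_group S" for h
    using inner_mapping_group_twisted[OF that] by (simp add: twisted_maps_def)
  note [simp] = rtrans_Bij inner_map_Bij eta_Bij Bij_mem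
  have mc [simp]: "a \<otimes>\<^bsub>M\<^esub> b \<in> Bij (carrier S)" if "a \<in> Bij (carrier S)" "b \<in> Bij (carrier S)" for a b
    using M.m_closed that by simp
  have m1: "(a, \<one>) \<otimes>\<^bsub>GSS S\<^esub> (b, y) = (a \<otimes>\<^bsub>M\<^esub> b, y)" for a b y by (simp add: GSS_def)
  have m2: "(a, x) \<otimes>\<^bsub>GSS S\<^esub> (b, y)
      = (a \<otimes>\<^bsub>M\<^esub> eta S b \<otimes>\<^bsub>M\<^esub> inner_map S (b x) y, b x \<otimes> y)" if "x \<noteq> \<one>" for a b x y
    using that by (simp add: GSS_def)
  have closed: "p \<otimes>\<^bsub>GSS S\<^esub> q \<in> carrier (GSS S)"
    if "p \<in> carrier (GSS S)" "q \<in> carrier (GSS S)" for p q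
  proof -
    obtain a x b y where "p = (a, x)" "q = (b, y)" by fastforce
    with that show ?thesis by (cases "x = \<one>") (auto simp: c m1 m2 eta_closed inc)
  qed
  have hom: "to_perm (p \<otimes>\<^bsub>GSS S\<^esub> q) = to_perm p \<otimes>\<^bsub>M\<^esub> to_perm q"
    if "p \<in> carrier (GSS S)" "q \<in> carrier (GSS S)" for p q
  proof -
    obtain a x b y where pq: "p = (a, x)" "q = (b, y)" by fastforce
    have m [simp]: "a \<in> inner_mapping_group S" "b \<in> inner_mapping_group S"
        "x \<in> carrier S" "y \<in> carrier S"
      using that pq by (auto simp: c)
    show ?thesis
    proof (cases "x = \<one>")
      case True
      have "rtrans \<one> = \<one>\<^bsub>M\<^esub>" by (auto simp: rtrans_def)
      moreover have "a \<otimes>\<^bsub>M\<^esub> \<one>\<^bsub>M\<^esub> = a" by (rule M.r_one) simp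
      ultimately have "a \<otimes>\<^bsub>M\<^esub> rtrans \<one> = a" by metis
      then have pa: "to_perm p = a" unfolding pq to_perm_def True prod.case .
      show ?thesis unfolding pa using True by (simp add: pq m1 to_perm_def M.m_assoc)
    next
      case False
      have "rtrans x \<otimes>\<^bsub>M\<^esub> b = eta S b \<otimes>\<^bsub>M\<^esub> rtrans (b x)"
        using inner_mapping_group_twisted[OF m(2)] False by (simp add: twisted_maps_def)
      then have "a \<otimes>\<^bsub>M\<^esub> rtrans x \<otimes>\<^bsub>M\<^esub> (b \<otimes>\<^bsub>M\<^esub> rtrans y)
          = a \<otimes>\<^bsub>M\<^esub> (eta S b \<otimes>\<^bsub>M\<^esub> rtrans (b x) \<otimes>\<^bsub>M\<^esub> rtrans y)"
        using M.m_assoc[of "rtrans x" b "rtrans y"] by (simp add: M.m_assoc)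
      then show ?thesis
        using False rtrans_mult[of "b x" y] by (simp add: pq m2 to_perm_def M.m_assoc)
    qed
  qed
  have inj: "p = q" if "p \<in> carrier (GSS S)" "q \<in> carrier (GSS S)" "to_perm p = to_perm q" for p q
  proof -
    obtain a x b y where pq: "p = (a, x)" "q = (b, y)" by fastforce
    have m [simp]: "a \<in> inner_mapping_group S" "b \<in> inner_mapping_group S"
        "x \<in> carrier S" "y \<in> carrier S"
      using that pq by (auto simp: c)
    have eq: "a \<otimes>\<^bsub>M\<^esub> rtrans x = b \<otimes>\<^bsub>M\<^esub> rtrans y" using that by (simp add: pq to_perm_def)
    have "x = y" using fun_cong[OF eq, of \<one>] by (simp add: Sym_mult) (simp add: rtrans_def fix1)
    then show ?thesis using eq M.right_cancel[of "rtrans x" a b] by (simp add: pq)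
  qed
  have tc: "to_perm p \<in> Bij (carrier S)" if "p \<in> carrier (GSS S)" for p
    using that by (auto simp: c to_perm_def)
  have l1: "\<one>\<^bsub>GSS S\<^esub> \<otimes>\<^bsub>GSS S\<^esub> p = p" if "p \<in> carrier (GSS S)" for p
    using that M.l_one by (auto simp: o m1 c simp del: Sym_simps(2))
  show ?thesis
  proof (rule groupI)
    fix p q r assume pqr: "p \<in> carrier (GSS S)" "q \<in> carrier (GSS S)" "r \<in> carrier (GSS S)"
    show "p \<otimes>\<^bsub>GSS S\<^esub> q \<otimes>\<^bsub>GSS S\<^esub> r = p \<otimes>\<^bsub>GSS S\<^esub> (q \<otimes>\<^bsub>GSS S\<^esub> r)"
      by (rule inj) (use pqr in \<open>auto simp: closed hom tc M.m_assoc\<close>)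
  next
    fix p assume p: "p \<in> carrier (GSS S)"
    obtain a x where ax: "p = (a, x)" by fastforce
    have m [simp]: "a \<in> inner_mapping_group S" "x \<in> carrier S" using p ax by (auto simp: c)
    define b where "b = inv\<^bsub>M\<^esub> a"
    have b [simp]: "b \<in> inner_mapping_group S" using b_def by simp
    have ba: "b \<otimes>\<^bsub>M\<^esub> a = \<one>\<^bsub>M\<^esub>" using b_def M.l_inv[of a] by simp
    show "\<exists>q\<in>carrier (GSS S). q \<otimes>\<^bsub>GSS S\<^esub> p = \<one>\<^bsub>GSS S\<^esub>"
    proof (cases "x = \<one>")
      case True
      then show ?thesis using ba by (intro bexI[of _ "(b, \<one>)"]) (auto simp: ax c o m1)
    next
      case False
      define y where "y = b (left_inv S x)"
      have lx: "left_inv S x \<in> carrier S - {\<one>}"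
        using left_inv[of x] left_inv_left_inv[of x] left_inv_one False by auto
      have y: "y \<in> carrier S - {\<one>}"
        unfolding y_def by (rule twisted_maps_nontriv[OF _ _ lx]) (auto simp: fix1)
      have ay: "a y = left_inv S x"
        using fun_cong[OF ba, of "left_inv S x"] lx by (simp add: Sym_mult y_def)
      have "eta S b \<otimes>\<^bsub>M\<^esub> eta S a = \<one>\<^bsub>M\<^esub>" using eta_mult[of b a] ba eta_one by simp
      then have "(eta S b, y) \<otimes>\<^bsub>GSS S\<^esub> p = \<one>\<^bsub>GSS S\<^esub>"
        using y ay inner_map_left_inv[of x] M.l_one[of "\<one>\<^bsub>M\<^esub>"] left_inv[of x]
        by (simp add: ax m2 o id_Bij)
      then show ?thesis using y by (intro bexI[of _ "(eta S b, y)"]) (auto simp: c eta_closed)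
    qed
  qed (use closed l1 in \<open>auto simp: c o G.one_closed[simplified]\<close>)
qed

end

end

theory Submission
  imports Defs
begin

text \<open>
  The right Bol identity \<open>((u \<otimes> x) \<otimes> y) \<otimes> x = u \<otimes> ((x \<otimes> y) \<otimes> x)\<close> is the link between the
  two sides. In terms of inner mappings it says that \<open>f(x, y)\<close> followed by \<open>f(x \<otimes> y, x)\<close> is the
  identity, because this composite carries \<open>u\<close> to the solution \<open>t\<close> of
  \<open>t \<otimes> ((x \<otimes> y) \<otimes> x) = ((u \<otimes> x) \<otimes> y) \<otimes> x\<close>. On the other hand, the product of
  \<open>(I, x)\<close>, \<open>(I, y)\<close> and \<open>(I, x)\<close> in the group on \<open>G\<^sub>S \<times> S\<close> has exactly this composite as its
  first component. Hence \<open>S\<close> is a twisted subgroup if and only if it satisfies the right Bol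
  identity (\<open>twisted_subgroup_iff_right_bol\<close>).

  Since \<open>f(y', y) = I\<close>, right multiplication by \<open>y'\<close> undoes right multiplication by \<open>y\<close>. So
  \<open>f(x, y)\<close> is always inverted by \<open>f(x \<otimes> y, y')\<close>, and the right loop property, applied to the
  pair \<open>x \<otimes> y, y'\<close> with product \<open>x\<close>, turns this mapping into \<open>f(x \<otimes> y, x)\<close>: this is
  the right Bol identity. That identity alone makes \<open>f(y, x)\<close> inverse to \<open>f(x, y)\<close>
  (\<open>right_bol_imp_inner_map_inverse\<close>).
  Conversely, if both \<open>f(x \<otimes> y, x)\<close> and \<open>f(y, x)\<close> invert \<open>f(x, y)\<close>, then
  \<open>f(x, x \<otimes> y) = f(x \<otimes> y, x)\<^sup>-\<^sup>1 = f(x, y)\<close>.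
\<close>

definition right_bol :: "('a, 'b) monoid_scheme \<Rightarrow> bool"
  where "right_bol S \<longleftrightarrow> (\<forall>u\<in>carrier S. \<forall>x\<in>carrier S. \<forall>y\<in>carrier S.
    u \<otimes>\<^bsub>S\<^esub> x \<otimes>\<^bsub>S\<^esub> y \<otimes>\<^bsub>S\<^esub> x = u \<otimes>\<^bsub>S\<^esub> (x \<otimes>\<^bsub>S\<^esub> y \<otimes>\<^bsub>S\<^esub> x))"

context right_loop
begin

lemma inner_map_eqI:
  assumes "x \<in> carrier S" "y \<in> carrier S" "u \<in> carrier S" "v \<in> carrier S"
    and "v \<otimes> (x \<otimes> y) = u \<otimes> x \<otimes> y"
  shows "inner_map S x y u = v"
  using assms by (intro right_cancel[of _ v "x \<otimes> y"]) (simp_all add: inner_map)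

lemma inner_map_one_left: "y \<in> carrier S \<Longrightarrow> inner_map S \<one> y = \<one>\<^bsub>Sym (carrier S)\<^esub>"
  by (intro Bij_eqI[of _ "carrier S"]) (simp_all add: inner_map_Bij id_Bij inner_map_eqI)

lemma inner_map_mult_eq_one_iff:
  assumes "x \<in> carrier S" "y \<in> carrier S" "z \<in> carrier S" "w \<in> carrier S"
  shows "inner_map S x y \<otimes>\<^bsub>Sym (carrier S)\<^esub> inner_map S z w = \<one>\<^bsub>Sym (carrier S)\<^esub>
    \<longleftrightarrow> (\<forall>u\<in>carrier S. inner_map S z w (inner_map S x y u) = u)"
  using assms by (auto simp: Sym_mult inner_map_Bij restrict_def fun_eq_iff)

lemma right_bol_iff_inner_map:
  "right_bol S \<longleftrightarrow> (\<forall>x\<in>carrier S. \<forall>y\<in>carrier S.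
    inner_map S x y \<otimes>\<^bsub>Sym (carrier S)\<^esub> inner_map S (x \<otimes> y) x = \<one>\<^bsub>Sym (carrier S)\<^esub>)"
proof -
  have "inner_map S (x \<otimes> y) x (inner_map S x y u) = u
      \<longleftrightarrow> u \<otimes> x \<otimes> y \<otimes> x = u \<otimes> (x \<otimes> y \<otimes> x)"
    if [simp]: "u \<in> carrier S" "x \<in> carrier S" "y \<in> carrier S" for u x y
  proof -
    have v: "inner_map S x y u \<in> carrier S" by (simp add: inner_map)
    have "inner_map S (x \<otimes> y) x (inner_map S x y u) \<otimes> (x \<otimes> y \<otimes> x) = u \<otimes> x \<otimes> y \<otimes> x"
      using inner_map(2)[of "inner_map S x y u" "x \<otimes> y" x] v by (simp add: inner_map(2))
    then show ?thesis
      using right_cancel[of _ u "x \<otimes> y \<otimes> x"] inner_map(1)[OF v, of "x \<otimes> y" x] by auto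
  qed
  then show ?thesis
    unfolding right_bol_def by (simp add: inner_map_mult_eq_one_iff del: Sym_simps) blast
qed

end

context twisted_right_gyrogroup
begin

lemma mult_right_inv_cancel:
  assumes "a \<in> carrier S" "y \<in> carrier S"
  shows "a \<otimes> y \<otimes> left_inv S y = a"
proof -
  have "inner_map S y (left_inv S y) a = a"
    using inner_map_left_inv[of "left_inv S y"] assms by (simp add: left_inv left_inv_left_inv)
  then show ?thesis
    using inner_map(2)[of a y "left_inv S y"] assms by (simp add: left_inv right_inv)
qed

text \<open>As \<open>(x \<otimes> y) \<otimes> y' = x\<close>, the second mapping carries \<open>v = f(x, y)(u)\<close> to the solution
  \<open>t\<close> of \<open>t \<otimes> x = (v \<otimes> (x \<otimes> y)) \<otimes> y'\<close>. The right-hand side is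
  \<open>((u \<otimes> x) \<otimes> y) \<otimes> y' = u \<otimes> x\<close>, so \<open>t = u\<close>.\<close>

lemma inner_map_inverse:
  assumes [simp]: "x \<in> carrier S" "y \<in> carrier S"
  shows "inner_map S x y \<otimes>\<^bsub>M\<^esub> inner_map S (x \<otimes> y) (left_inv S y) = \<one>\<^bsub>M\<^esub>"
proof -
  have "inner_map S (x \<otimes> y) (left_inv S y) (inner_map S x y u) = u" if "u \<in> carrier S" for u
    using that by (intro inner_map_eqI) (simp_all add: inner_map left_inv mult_right_inv_cancel)
  then show ?thesis by (simp add: inner_map_mult_eq_one_iff left_inv del: Sym_simps)
qed

lemma right_loop_property_imp_right_bol:
  assumes loop: "\<And>x y. \<lbrakk>x \<in> carrier S; y \<in> carrier S\<rbrakk> \<Longrightarrow> inner_map S x y = inner_map S x (x \<otimes> y)"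
  shows "right_bol S"
  unfolding right_bol_iff_inner_map
proof (intro ballI)
  fix x y assume xy: "x \<in> carrier S" "y \<in> carrier S"
  then have "inner_map S (x \<otimes> y) (left_inv S y) = inner_map S (x \<otimes> y) x"
    using loop[of "x \<otimes> y" "left_inv S y"] by (simp add: left_inv mult_right_inv_cancel)
  then show "inner_map S x y \<otimes>\<^bsub>M\<^esub> inner_map S (x \<otimes> y) x = \<one>\<^bsub>M\<^esub>"
    using inner_map_inverse[OF xy] by simp
qed

text \<open>For right translations \<open>R\<^sub>x\<close>, composed from left to right, the right Bol identity
  states \<open>R\<^sub>x R\<^sub>y R\<^sub>x = R\<^sub>z\<close> with
  \<open>z = (x \<otimes> y) \<otimes> x\<close>. As inverses of right translations are right translations, so is
  \<open>R\<^sub>x (R\<^sub>y p\<^sup>-\<^sup>1 R\<^sub>y) R\<^sub>x\<close> for \<open>p\<close> the right translation by \<open>x \<otimes> y\<close>. It carries \<open>\<one>\<close> to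
  \<open>y \<otimes> x\<close>, hence is the right translation by \<open>y \<otimes> x\<close>. But \<open>R\<^sub>x R\<^sub>y p\<^sup>-\<^sup>1\<close> is
  \<open>f(x, y)\<close>, and \<open>R\<^sub>y R\<^sub>x\<close> is \<open>f(y, x)\<close> followed by that same translation.\<close>

lemma right_bol_imp_inner_map_inverse:
  assumes bol: "right_bol S" and [simp]: "x \<in> carrier S" "y \<in> carrier S"
  shows "inner_map S x y \<otimes>\<^bsub>M\<^esub> inner_map S y x = \<one>\<^bsub>M\<^esub>"
proof -
  have bol': "a \<otimes> b \<otimes> c \<otimes> b = a \<otimes> (b \<otimes> c \<otimes> b)"
    if "a \<in> carrier S" "b \<in> carrier S" "c \<in> carrier S" for a b c
    using bol that unfolding right_bol_def by blast
  define p' where "p' = left_inv S (x \<otimes> y)"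
  \<comment> \<open>By the right Bol identity, right multiplication by \<open>w\<close> is multiplication by \<open>y\<close>, \<open>p'\<close>, \<open>y\<close>
    in turn.\<close>
  define w where "w = y \<otimes> p' \<otimes> y"
  have [simp]: "p' \<in> carrier S" "w \<in> carrier S" by (simp_all add: p'_def w_def left_inv)
  have "x \<otimes> w = x \<otimes> y \<otimes> p' \<otimes> y" by (simp add: w_def bol')
  also have "\<dots> = y" by (simp add: p'_def right_inv)
  finally have xw: "x \<otimes> w = y" .
  have "inner_map S y x (inner_map S x y u) = u" if [simp]: "u \<in> carrier S" for u
  proof (rule inner_map_eqI)
    have v: "inner_map S x y u \<in> carrier S" by (simp add: inner_map)
    have "inner_map S x y u = inner_map S x y u \<otimes> (x \<otimes> y) \<otimes> p'"
      using mult_right_inv_cancel[OF v, of "x \<otimes> y"] by (simp add: p'_def)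
    also have "\<dots> = u \<otimes> x \<otimes> y \<otimes> p'" by (simp add: inner_map(2))
    finally have "inner_map S x y u \<otimes> y \<otimes> x = u \<otimes> x \<otimes> y \<otimes> p' \<otimes> y \<otimes> x" by simp
    also have "\<dots> = u \<otimes> x \<otimes> w \<otimes> x" by (simp add: w_def bol'[of "u \<otimes> x"])
    also have "\<dots> = u \<otimes> (y \<otimes> x)" by (simp add: bol'[of u x w] xw)
    finally show "u \<otimes> (y \<otimes> x) = inner_map S x y u \<otimes> y \<otimes> x" by simp
  qed (simp_all add: inner_map)
  then show ?thesis by (simp add: inner_map_mult_eq_one_iff del: Sym_simps)
qed

text \<open>The multiplication of \<^term>\<open>GSS S\<close> is defined by cases; on \<open>S\<close> the two cases agree because
  \<open>f(\<one>, y)\<close> is the identity.\<close>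

lemma GSS_sandwich:
  assumes [simp]: "x \<in> carrier S" "y \<in> carrier S"
  shows "(\<one>\<^bsub>M\<^esub>, x) \<otimes>\<^bsub>GSS S\<^esub> (\<one>\<^bsub>M\<^esub>, y) \<otimes>\<^bsub>GSS S\<^esub> (\<one>\<^bsub>M\<^esub>, x)
    = (inner_map S x y \<otimes>\<^bsub>M\<^esub> inner_map S (x \<otimes> y) x, x \<otimes> y \<otimes> x)"
proof -
  interpret M: group M by (rule group_Sym)
  have B: "inner_map S a b \<in> carrier M" if "a \<in> carrier S" "b \<in> carrier S" for a b
    using that by (simp add: inner_map_Bij)
  have app: "\<one>\<^bsub>M\<^esub> a = a" if "a \<in> carrier S" for a using that by simp
  have mult: "(a, z) \<otimes>\<^bsub>GSS S\<^esub> (\<one>\<^bsub>M\<^esub>, v) = (a \<otimes>\<^bsub>M\<^esub> inner_map S z v, z \<otimes> v)"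
    if "a \<in> carrier M" "z \<in> carrier S" "v \<in> carrier S" for a z v
    using that by (simp add: GSS_def app eta_one inner_map_one_left del: Sym_simps)
  show ?thesis by (simp add: mult B del: Sym_simps)
qed

lemma twisted_subgroup_iff_right_bol:
  "twisted_subgroup (GSS S) (GSS_embed S) \<longleftrightarrow> right_bol S"
proof -
  have E: "GSS_embed S = Pair \<one>\<^bsub>M\<^esub> ` carrier S"
    by (auto simp: GSS_embed_def)
  have "GSS_embed S \<subseteq> carrier (GSS S)"
    using subgroup.one_closed[OF inner_mapping_group_subgroup]
    by (auto simp: E GSS_def simp del: Sym_simps)
  moreover have "\<one>\<^bsub>GSS S\<^esub> \<in> GSS_embed S" by (simp add: E GSS_def)
  ultimately have "twisted_subgroup (GSS S) (GSS_embed S) \<longleftrightarrow>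
      (\<forall>p\<in>GSS_embed S. \<forall>q\<in>GSS_embed S. p \<otimes>\<^bsub>GSS S\<^esub> q \<otimes>\<^bsub>GSS S\<^esub> p \<in> GSS_embed S)"
    using group_GSS by (auto simp: twisted_subgroup_def twisted_subgroup_axioms_def)
  also have "\<dots> \<longleftrightarrow> (\<forall>x\<in>carrier S. \<forall>y\<in>carrier S.
      inner_map S x y \<otimes>\<^bsub>M\<^esub> inner_map S (x \<otimes> y) x = \<one>\<^bsub>M\<^esub>)"
    by (simp add: E GSS_sandwich image_iff del: Sym_simps)
  finally show ?thesis by (simp only: right_bol_iff_inner_map)
qed

end

theorem theorem6p4:
  fixes S :: "('a, 'b) monoid_scheme" (structure)
  assumes "twisted_right_gyrogroup S"
  shows "twisted_gyrogroup S \<longleftrightarrow>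
    twisted_subgroup (GSS S) (GSS_embed S) \<and>
    (\<forall>x\<in>carrier S. \<forall>y\<in>carrier S.
      inv\<^bsub>Sym (carrier S)\<^esub> (inner_map S x y) = inner_map S y x)"
proof -
  interpret twisted_right_gyrogroup S by (rule assms)
  interpret M: group "Sym (carrier S)" by (rule group_Sym)
  have B: "inner_map S x y \<in> carrier (Sym (carrier S))" if "x \<in> carrier S" "y \<in> carrier S" for x y
    using that by (simp add: inner_map_Bij)
  have inv_eq: "inv\<^bsub>Sym (carrier S)\<^esub> (inner_map S x y) = inner_map S z w"
    if "x \<in> carrier S" "y \<in> carrier S" "z \<in> carrier S" "w \<in> carrier S"
      "inner_map S x y \<otimes>\<^bsub>Sym (carrier S)\<^esub> inner_map S z w = \<one>\<^bsub>Sym (carrier S)\<^esub>" for x y z w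
    using that M.inv_unique'[of "inner_map S x y" "inner_map S z w"] M.inv_comm B by metis
  show ?thesis
    unfolding twisted_subgroup_iff_right_bol
  proof (intro iffI conjI ballI)
    assume "twisted_gyrogroup S"
    then show bol: "right_bol S"
      by (intro right_loop_property_imp_right_bol twisted_gyrogroup.right_loop_property)
    fix x y assume "x \<in> carrier S" "y \<in> carrier S"
    then show "inv\<^bsub>Sym (carrier S)\<^esub> (inner_map S x y) = inner_map S y x"
      by (intro inv_eq right_bol_imp_inner_map_inverse bol)
  next
    assume *: "right_bol S \<and> (\<forall>x\<in>carrier S. \<forall>y\<in>carrier S.
      inv\<^bsub>Sym (carrier S)\<^esub> (inner_map S x y) = inner_map S y x)"
    show "twisted_gyrogroup S"
    proof (intro twisted_gyrogroup.intro assms twisted_gyrogroup_axioms.intro)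
      fix x y assume xy: "x \<in> carrier S" "y \<in> carrier S"
      have "inner_map S (x \<otimes> y) x = inv\<^bsub>Sym (carrier S)\<^esub> (inner_map S x y)"
        using * xy by (intro inv_eq[symmetric]) (simp_all add: right_bol_iff_inner_map)
      moreover have "inner_map S x (x \<otimes> y) = inv\<^bsub>Sym (carrier S)\<^esub> (inner_map S (x \<otimes> y) x)"
        using * xy by simp
      ultimately show "inner_map S x y = inner_map S x (x \<otimes> y)"
        using M.inv_inv[OF B[OF xy]] by simp
    qed
  qed
qed

end
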